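(* Let $\mathcal{C}$ be an $[n,k,d]_q$ MDS code with $d\ge 5$. Let $\mathcal{V}_a^{(2)}$ and $\mathcal{V}_b^{(2)}$ be two of its weight $2$ cosets with different weight distributions. Then, independently of the values of $B_{d-2}(\mathcal{V}_a^{(2)})$ and $B_{d-2}(\mathcal{V}_b^{(2)})$, $$(-1)^{n+d}B_w(\mathcal{V}_a^{(2)})-B_{n+d-2-w}(\mathcal{V}_a^{(2)})=(-1)^{n+d}B_w(\mathcal{V}_b^{(2)})-B_{n+d-2-w}(\mathcal{V}_b^{(2)})$$ for all $w=d-1,d,\ldots,n$.
   Context: An $[n,k,d]_q$ code is a $k$-dimensional $\mathbb{F}_q$-linear subspace of $\mathbb{F}_q^n$ with minimum Hamming distance $d$; it is MDS if $d=n-k+1$. A coset of $\mathcal{C}$ is a translate $\mathcal{C}+\mathbf{v}$, $\mathbf{v}\in\mathbb{F}_q^n$; the weight of a coset is the smallest Hamming weight of a vector in it. $B_w(\mathcal{V})$ is the number of vectors of Hamming weight $w$ in the coset $\mathcal{V}$; the weight distribution of $\mathcal{V}$ is the sequence $(B_w(\mathcal{V}))_{0\le w\le n}$. *)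

theory Defs
  imports "HOL-Analysis.Cartesian_Space"
begin

text \<open>
  The field of \<open>q\<close> elements is a type \<open>'a :: {field, finite}\<close> with \<open>q = CARD('a)\<close>, and
  the ambient space of dimension \<open>n\<close> over it is \<open>'a ^ 'n\<close> with \<open>n = CARD('n)\<close>.
\<close>

definition hamming_weight :: "'a::zero ^ 'n \<Rightarrow> nat" where
  "hamming_weight x = card {i. x $ i \<noteq> 0}"

definition hamming_dist :: "'a ^ 'n \<Rightarrow> 'a ^ 'n \<Rightarrow> nat" where
  "hamming_dist x y = card {i. x $ i \<noteq> y $ i}"

text \<open>Only meaningful for a code with at least two words; otherwise the set below is empty.\<close>

definition min_dist :: "('a::finite ^ 'n) set \<Rightarrow> nat" where
  "min_dist C = Min {hamming_dist x y |x y. x \<in> C \<and> y \<in> C \<and> x \<noteq> y}"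

text \<open>
  The zero code has no minimum distance, hence the condition \<open>1 \<le> k\<close>.
\<close>

definition linear_code :: "nat \<Rightarrow> nat \<Rightarrow> nat \<Rightarrow> nat \<Rightarrow> ('a::{field,finite} ^ 'n) set \<Rightarrow> bool" where
  "linear_code n k d q C \<longleftrightarrow>
     n = CARD('n) \<and> q = CARD('a) \<and>
     vec.subspace C \<and> vec.dim C = k \<and> 1 \<le> k \<and> min_dist C = d"

text \<open>Since \<open>k \<le> n\<close> for every linear code, the subtraction below is never truncated.\<close>

definition mds_code :: "nat \<Rightarrow> nat \<Rightarrow> nat \<Rightarrow> nat \<Rightarrow> ('a::{field,finite} ^ 'n) set \<Rightarrow> bool" where
  "mds_code n k d q C \<longleftrightarrow> linear_code n k d q C \<and> d = n - k + 1"

definition is_coset :: "('a::{field,finite} ^ 'n) set \<Rightarrow> ('a ^ 'n) set \<Rightarrow> bool" where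
  "is_coset C V \<longleftrightarrow> (\<exists>v. V = (\<lambda>c. c + v) ` C)"

definition coset_weight :: "('a::{field,finite} ^ 'n) set \<Rightarrow> nat" where
  "coset_weight V = Min (hamming_weight ` V)"

definition weight_count :: "nat \<Rightarrow> ('a::{field,finite} ^ 'n) set \<Rightarrow> nat" where
  "weight_count w V = card {x \<in> V. hamming_weight x = w}"

definition weight_distribution :: "('a::{field,finite} ^ 'n) set \<Rightarrow> nat list" where
  "weight_distribution V = map (\<lambda>w. weight_count w V) [0..<CARD('n) + 1]"

end

theory Submission
  imports Defs "HOL-Library.FuncSet"
begin

text \<open>
  Counting the vectors of a coset that vanish on a given set of \<open>t \<le> k\<close> coordinates gives the
  binomial moments \<open>\<Sum>w. B\<^sub>w (n - w choose t) = (n choose t) q ^ (k - t)\<close>, which are the same for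
  all cosets. In a coset of weight \<open>2\<close> the vector of weight \<open>2\<close> is the only one of weight at most
  \<open>d - 3\<close>. Hence the differences of the \<open>B\<^sub>w\<close> of two such cosets vanish for \<open>w \<le> d - 3\<close> and have
  vanishing binomial moments, which forces the difference at \<open>d - 2 + j\<close> to be
  \<open>(-1) ^ j (m choose j)\<close> times the one at \<open>d - 2\<close>, where \<open>m = n - d + 2\<close>. The theorem is the
  symmetry of the binomial coefficients.
\<close>

lemma card_subspace_eq:
  fixes C :: "('a::{field,finite} ^ 'n) set"
  assumes "vec.subspace C"
  shows "card C = CARD('a) ^ vec.dim C"
proof -
  obtain B where B: "B \<subseteq> C" "vec.independent B" "C \<subseteq> vec.span B" "card B = vec.dim C"
    using vec.basis_exists[of C] by blast
  have fin: "finite B" by simp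
  have span: "vec.span B = C"
    using B(1,3) assms vec.span_minimal by blast
  let ?h = "\<lambda>f. \<Sum>b\<in>B. f b *s b"
  \<comment> \<open>Coordinates with respect to the basis \<open>B\<close>. Values off
    \<open>B\<close> do not enter the sum, so injectivity requires extensional functions.\<close>
  have "bij_betw ?h (B \<rightarrow>\<^sub>E UNIV) C"
  proof (rule bij_betw_imageI)
    show "inj_on ?h (B \<rightarrow>\<^sub>E UNIV)"
    proof (rule inj_onI)
      fix f g assume f: "f \<in> B \<rightarrow>\<^sub>E UNIV" and g: "g \<in> B \<rightarrow>\<^sub>E UNIV" and eq: "?h f = ?h g"
      have 0: "(\<Sum>b\<in>B. (f b - g b) *s b) = 0"
        using eq by (simp add: vec.scale_left_diff_distrib sum_subtractf)
      have "f b = g b" if "b \<in> B" for b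
        using vec.independentD[OF B(2) fin order_refl 0 that] by simp
      then show "f = g" using PiE_ext[OF f g] by blast
    qed
    show "?h ` (B \<rightarrow>\<^sub>E UNIV) = C"
    proof
      show "?h ` (B \<rightarrow>\<^sub>E UNIV) \<subseteq> C"
      proof (rule image_subsetI)
        fix f
        have "f b *s b \<in> C" if "b \<in> B" for b
          using that B(1) assms by (auto intro: vec.subspace_scale)
        then show "?h f \<in> C" by (rule vec.subspace_sum[OF assms])
      qed
      show "C \<subseteq> ?h ` (B \<rightarrow>\<^sub>E UNIV)"
      proof
        fix x assume "x \<in> C"
        then obtain u where "x = ?h u"
          using span vec.span_finite[OF fin] by auto
        then have "x = ?h (restrict u B)" by simp
        moreover have "restrict u B \<in> B \<rightarrow>\<^sub>E UNIV" by simp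
        ultimately show "x \<in> ?h ` (B \<rightarrow>\<^sub>E UNIV)" by (rule image_eqI)
      qed
    qed
  qed
  then have "card C = card (B \<rightarrow>\<^sub>E (UNIV :: 'a set))"
    by (simp add: bij_betw_same_card)
  then show ?thesis by (simp add: card_PiE B(4))
qed

lemma min_dist_le_hamming_dist:
  fixes C :: "('a::finite ^ 'n) set"
  assumes "x \<in> C" "y \<in> C" "x \<noteq> y"
  shows "min_dist C \<le> hamming_dist x y"
proof -
  have "{hamming_dist x y |x y. x \<in> C \<and> y \<in> C \<and> x \<noteq> y} \<subseteq> (\<lambda>(x, y). hamming_dist x y) ` (C \<times> C)"
    by auto
  then have "finite {hamming_dist x y |x y. x \<in> C \<and> y \<in> C \<and> x \<noteq> y}"
    by (rule finite_subset) simp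
  then show ?thesis
    unfolding min_dist_def by (rule Min_le) (use assms in auto)
qed

lemma coset_diff_mem:
  fixes C V :: "('a::{field,finite} ^ 'n) set"
  assumes "vec.subspace C" "is_coset C V" "x \<in> V" "y \<in> V"
  shows "x - y \<in> C"
  using assms by (auto simp: is_coset_def intro: vec.subspace_diff)

lemma card_coset:
  assumes "is_coset C V"
  shows "card V = card C"
  using assms by (auto simp: is_coset_def intro!: card_image inj_onI)

text \<open>Two vectors of a coset differ by a codeword, and subtracting \<open>y\<close> from both
  keeps their distance.\<close>

lemma min_dist_le_coset_dist:
  fixes C V :: "('a::{field,finite} ^ 'n) set"
  assumes C: "vec.subspace C" and V: "is_coset C V" and xy: "x \<in> V" "y \<in> V" "x \<noteq> y"
  shows "min_dist C \<le> hamming_dist x y"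
proof -
  have "min_dist C \<le> hamming_dist (x - y) 0"
    by (rule min_dist_le_hamming_dist)
      (use coset_diff_mem[OF C V xy(1,2)] xy vec.subspace_0[OF C] in auto)
  then show ?thesis by (simp add: hamming_dist_def)
qed

lemma hamming_dist_le_weights:
  "hamming_dist x y \<le> hamming_weight x + hamming_weight y"
proof -
  have "{i. x $ i \<noteq> y $ i} \<subseteq> {i. x $ i \<noteq> 0} \<union> {i. y $ i \<noteq> 0}" by auto
  then have "hamming_dist x y \<le> card ({i. x $ i \<noteq> 0} \<union> {i. y $ i \<noteq> 0})"
    unfolding hamming_dist_def by (intro card_mono) auto
  also have "\<dots> \<le> hamming_weight x + hamming_weight y"
    unfolding hamming_weight_def by (rule card_Un_le)
  finally show ?thesis .
qed

lemma mds_codeD: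
  fixes C :: "('a::{field,finite} ^ 'n) set"
  assumes "mds_code n k d q C"
  shows "vec.subspace C" "min_dist C = d" "CARD('n) = n" "k \<le> n" "n + 1 = d + k"
    "card C = CARD('a) ^ k"
proof -
  show C: "vec.subspace C" "min_dist C = d" "CARD('n) = n"
    using assms by (auto simp: mds_code_def linear_code_def)
  have k: "vec.dim C = k" using assms by (auto simp: mds_code_def linear_code_def)
  show "k \<le> n" using vec.dim_subset[of C UNIV] k C(3) by (simp only: subset_UNIV vec_dim_card)
  then show "n + 1 = d + k" using assms by (auto simp: mds_code_def)
  show "card C = CARD('a) ^ k" using card_subspace_eq[OF C(1)] k by simp
qed

text \<open>Vectors of the coset that agree on \<open>k\<close> coordinates are at distance at most
  \<open>n - k < d\<close>, hence equal. So restriction to any \<open>k\<close> coordinates is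
  injective and, as the coset has \<open>CARD('a) ^ k\<close> elements, onto: every prescription of
  \<open>k\<close> coordinates is met exactly once.\<close>

lemma card_coset_vanishing:
  fixes C V :: "('a::{field,finite} ^ 'n) set"
  assumes mds: "mds_code n k d q C" and V: "is_coset C V" and T: "card T \<le> k"
  shows "card {x \<in> V. \<forall>i\<in>T. x $ i = 0} = CARD('a) ^ (k - card T)"
proof -
  note C = mds_codeD[OF mds]
  \<comment> \<open>The coordinates in \<open>T' - T\<close> stay free and give the exponent
    \<open>k - card T\<close>.\<close>
  obtain T' where T': "T \<subseteq> T'" "card T' = k"
    using exists_subset_between[of T k UNIV] T C(3,4) by auto
  let ?r = "\<lambda>x. restrict (($) x) T'"
  have inj: "inj_on ?r V"
  proof (rule inj_onI, rule ccontr)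
    fix x y assume xy: "x \<in> V" "y \<in> V" "?r x = ?r y" "x \<noteq> y"
    have "x $ i = y $ i" if "i \<in> T'" for i
      using fun_cong[OF xy(3), of i] that by simp
    then have "{i. x $ i \<noteq> y $ i} \<subseteq> - T'" by auto
    then have "hamming_dist x y \<le> card (- T')"
      unfolding hamming_dist_def by (intro card_mono) auto
    also have "\<dots> = n - k"
      using T'(2) C(3) by (simp add: card_Diff_subset Compl_eq_Diff_UNIV)
    finally show False
      using min_dist_le_coset_dist[OF C(1) V xy(1,2,4)] C(2,4,5) by simp
  qed
  have "?r ` V = T' \<rightarrow>\<^sub>E UNIV"
  proof (rule card_subset_eq)
    show "finite (T' \<rightarrow>\<^sub>E (UNIV :: 'a set))" by (simp add: finite_PiE)
    show "?r ` V \<subseteq> T' \<rightarrow>\<^sub>E UNIV" by auto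
    show "card (?r ` V) = card (T' \<rightarrow>\<^sub>E (UNIV :: 'a set))"
      using card_image[OF inj] card_coset[OF V] C(6) T'(2) by (simp add: card_PiE)
  qed
  moreover have "?r ` {x \<in> V. \<forall>i\<in>T. x $ i = 0} = {f \<in> ?r ` V. \<forall>i\<in>T. f i = 0}"
  proof -
    have "(\<forall>i\<in>T. ?r x i = 0) \<longleftrightarrow> (\<forall>i\<in>T. x $ i = 0)" for x :: "'a ^ 'n"
      using T'(1) by (auto simp: subset_iff)
    then show ?thesis by (simp only: Compr_image_eq)
  qed
  moreover have "{f \<in> T' \<rightarrow>\<^sub>E UNIV. \<forall>i\<in>T. f i = 0} =
      (\<Pi>\<^sub>E i\<in>T'. if i \<in> T then {0::'a} else UNIV)"
    using T'(1) by (auto simp: PiE_iff extensional_def split: if_splits)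
  ultimately have "card {x \<in> V. \<forall>i\<in>T. x $ i = 0} =
      card (\<Pi>\<^sub>E i\<in>T'. if i \<in> T then {0::'a} else UNIV)"
    using card_image[OF inj_on_subset[OF inj, of "{x \<in> V. \<forall>i\<in>T. x $ i = 0}"]] by simp
  also have "\<dots> = (\<Prod>i\<in>T'. if i \<in> T then 1 else CARD('a))"
    by (simp add: card_PiE if_distrib cong: if_cong)
  also have "\<dots> = CARD('a) ^ card (T' - T)"
    by (simp add: prod.If_cases Diff_eq)
  also have "card (T' - T) = k - card T"
    using T' by (simp add: card_Diff_subset)
  finally show ?thesis .
qed

text \<open>Double count of the pairs of a vector of the coset and a \<open>t\<close>-set of
  coordinates on which it vanishes: a vector of weight \<open>w\<close> has \<open>n - w\<close>
  zeros to choose from, and each \<open>t\<close>-set serves the number of vectors given by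
  \<open>card_coset_vanishing\<close>.\<close>

lemma coset_binomial_moment:
  fixes C V :: "('a::{field,finite} ^ 'n) set"
  assumes mds: "mds_code n k d q C" and V: "is_coset C V" and t: "t \<le> k"
  shows "(\<Sum>w\<le>n. weight_count w V * ((n - w) choose t)) = (n choose t) * CARD('a) ^ (k - t)"
proof -
  note C = mds_codeD[OF mds]
  let ?P = "{T :: 'n set. card T = t}"
  let ?Z = "\<lambda>x :: 'a ^ 'n. {i. x $ i = 0}"
  have wt: "hamming_weight x \<le> n" for x :: "'a ^ 'n"
    unfolding hamming_weight_def C(3)[symmetric] by (intro card_mono) auto
  have zeros: "card (?Z x) = n - hamming_weight x" for x
  proof -
    have "?Z x = - {i. x $ i \<noteq> 0}" by auto
    then show ?thesis by (simp add: card_Diff_subset Compl_eq_Diff_UNIV hamming_weight_def C(3))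
  qed
  have inner: "card {T \<in> ?P. \<forall>i\<in>T. x $ i = 0} = (n - hamming_weight x) choose t" for x :: "'a ^ 'n"
  proof -
    have "{T \<in> ?P. \<forall>i\<in>T. x $ i = 0} = {T. T \<subseteq> ?Z x \<and> card T = t}" by auto
    then show ?thesis using n_subsets[of "?Z x" t] zeros[of x] by simp
  qed
  have "(\<Sum>w\<le>n. weight_count w V * ((n - w) choose t)) =
      (\<Sum>w\<le>n. \<Sum>x\<in>{x \<in> V. hamming_weight x = w}. (n - hamming_weight x) choose t)"
    by (simp add: weight_count_def)
  also have "\<dots> = (\<Sum>x\<in>V. (n - hamming_weight x) choose t)"
    by (rule sum.group) (use wt in auto)
  also have "\<dots> = (\<Sum>x\<in>V. card {T \<in> ?P. \<forall>i\<in>T. x $ i = 0})"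
    by (simp only: inner)
  also have "\<dots> = (\<Sum>T\<in>?P. card {x \<in> V. \<forall>i\<in>T. x $ i = 0})"
    using sum.swap_restrict[of V ?P "\<lambda>_ _. 1::nat" "\<lambda>x T. \<forall>i\<in>T. x $ i = 0"] by simp
  also have "\<dots> = (\<Sum>T\<in>?P. CARD('a) ^ (k - t))"
    by (rule sum.cong) (use card_coset_vanishing[OF mds V] t in auto)
  also have "\<dots> = (n choose t) * CARD('a) ^ (k - t)"
    using n_subsets[of "UNIV :: 'n set" t] C(3) by simp
  finally show ?thesis .
qed

text \<open>Any other vector of weight \<open>w\<close> in the coset would, by the triangle
  inequality through \<open>0\<close>, be closer to \<open>u\<close> than the minimum distance
  allows.\<close>

lemma weight_count_below:
  fixes C V :: "('a::{field,finite} ^ 'n) set"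
  assumes C: "vec.subspace C" and V: "is_coset C V"
    and u: "u \<in> V" "hamming_weight u + w < min_dist C"
  shows "weight_count w V = (if w = hamming_weight u then 1 else 0)"
proof -
  have eq: "x = u" if "x \<in> V" "hamming_weight x = w" for x
    using min_dist_le_coset_dist[OF C V that(1) u(1)] hamming_dist_le_weights[of x u] that u(2)
    by (cases "x = u") auto
  have "{x \<in> V. hamming_weight x = w} = (if w = hamming_weight u then {u} else {})"
    using u(1) by (auto dest: eq)
  then show ?thesis by (simp add: weight_count_def)
qed

lemma coset_weight_attained:
  fixes C V :: "('a::{field,finite} ^ 'n) set"
  assumes "vec.subspace C" "is_coset C V"
  obtains u where "u \<in> V" "hamming_weight u = coset_weight V"
proof -
  have "V \<noteq> {}" using assms vec.subspace_0 by (auto simp: is_coset_def)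
  then have "coset_weight V \<in> hamming_weight ` V"
    unfolding coset_weight_def by (intro Min_in) auto
  then show ?thesis using that by auto
qed

text \<open>The moment \<open>t = m - j\<close> involves only the \<open>E i\<close> with
  \<open>i \<le> j\<close>, and \<open>E j\<close> has coefficient \<open>1\<close> in it. The
  system is thus triangular and determines everything from \<open>E 0\<close>, which stays free;
  signed binomial coefficients solve it.\<close>

lemma vanishing_binomial_moments:
  fixes E :: "nat \<Rightarrow> 'a::comm_ring_1"
  assumes mom: "\<And>t. t < m \<Longrightarrow> (\<Sum>j\<le>m. E j * of_nat ((m - j) choose t)) = 0"
    and "j \<le> m"
  shows "E j = (-1) ^ j * of_nat (m choose j) * E 0"
  using \<open>j \<le> m\<close>
proof (induction j rule: less_induct)
  case (less j)
  show ?case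
  proof (cases "j = 0")
    case False
    let ?c = "\<lambda>i. of_nat ((m - i) choose (m - j)) :: 'a"
    have cut: "(\<Sum>i\<le>m. F i * ?c i) = F j + (\<Sum>i<j. F i * ?c i)" for F
    proof -
      have "(\<Sum>i\<le>m. F i * ?c i) = (\<Sum>i\<le>j. F i * ?c i)"
        using less.prems
        by (intro sum.mono_neutral_right) (auto simp: binomial_eq_0 diff_less_mono2 not_le)
      then show ?thesis
        by (simp add: lessThan_Suc_atMost[symmetric] add.commute)
    qed
    let ?G = "\<lambda>i. (-1) ^ i * of_nat (m choose i) * E 0"
    \<comment> \<open>\<open>?G\<close> satisfies the same recurrence: choosing \<open>i\<close> and
      then \<open>j - i\<close> of \<open>m\<close> elements amounts to choosing \<open>j\<close>
      and then \<open>i\<close> among them. So \<open>m choose j\<close> factors out, leaving an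
      alternating row sum that is zero for \<open>j \<noteq> 0\<close>.\<close>
    have "(\<Sum>i\<le>j. (-1) ^ i * of_nat (m choose i) * ?c i) =
        (\<Sum>i\<le>j. of_nat (m choose j) * ((-1) ^ i * of_nat (j choose i)))"
    proof (rule sum.cong[OF refl])
      fix i assume i: "i \<in> {..j}"
      have "(m - i) choose (m - j) = (m - i) choose (j - i)"
        using binomial_symmetric[of "j - i" "m - i"] i less.prems by simp
      then have "(m choose i) * ((m - i) choose (m - j)) = (m choose j) * (j choose i)"
        using choose_mult[of i j m] i less.prems by simp
      then have "of_nat (m choose i) * ?c i = of_nat (m choose j) * of_nat (j choose i)"
        by (simp only: of_nat_mult[symmetric])
      then show "(-1) ^ i * of_nat (m choose i) * ?c i =
          of_nat (m choose j) * ((-1) ^ i * of_nat (j choose i))"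
        by (simp only: mult.assoc mult.left_commute)
    qed
    also have "\<dots> = 0"
      using choose_alternating_sum[of j, where 'a='a] False by (simp flip: sum_distrib_left)
    finally have "(\<Sum>i\<le>j. (-1) ^ i * of_nat (m choose i) * ?c i) * E 0 = 0" by simp
    then have "?G j + (\<Sum>i<j. ?G i * ?c i) = 0"
      by (simp add: lessThan_Suc_atMost[symmetric] sum_distrib_left algebra_simps)
    moreover have "E j + (\<Sum>i<j. E i * ?c i) = 0"
      using cut[of E] mom[of "m - j"] less.prems False by simp
    moreover have "(\<Sum>i<j. E i * ?c i) = (\<Sum>i<j. ?G i * ?c i)"
    proof (rule sum.cong[OF refl])
      fix i assume "i \<in> {..<j}"
      then have "E i = ?G i" using less.IH[of i] less.prems by simp
      then show "E i * ?c i = ?G i * ?c i" by (rule arg_cong)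
    qed
    ultimately have "E j + (\<Sum>i<j. ?G i * ?c i) = ?G j + (\<Sum>i<j. ?G i * ?c i)"
      by (simp only:)
    then show ?thesis by (simp only: add_right_cancel)
  qed simp
qed

theorem theorem5p7:
  fixes C Va Vb :: "('a::{field,finite} ^ 'n) set"
    and n k d q :: nat
  assumes "mds_code n k d q C"
    and "d \<ge> 5"
    and "is_coset C Va" and "coset_weight Va = 2"
    and "is_coset C Vb" and "coset_weight Vb = 2"
    and "weight_distribution Va \<noteq> weight_distribution Vb"
  shows "\<forall>w\<in>{d - 1..n}.
    (- 1) ^ (n + d) * int (weight_count w Va) - int (weight_count (n + d - 2 - w) Va) =
    (- 1) ^ (n + d) * int (weight_count w Vb) - int (weight_count (n + d - 2 - w) Vb)"
proof
  fix w assume w: "w \<in> {d - 1..n}"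
  note C = mds_codeD[OF assms(1)]
  define D where "D w = int (weight_count w Va) - int (weight_count w Vb)" for w
  \<comment> \<open>There are \<open>m + 1\<close> weights from \<open>d - 2\<close> to
    \<open>n\<close>, and the available moments \<open>t \<le> k\<close> are those with
    \<open>t < m\<close>, one fewer than the unknowns.\<close>
  define m where "m = k + 1"
  have n: "n = d - 2 + m" using C(5) assms(2) by (simp add: m_def)
  have low: "weight_count i V = (if i = 2 then 1 else 0)"
    if "is_coset C V" "coset_weight V = 2" "i < d - 2" for V i
  proof -
    \<comment> \<open>A vector attaining the coset weight is the reference point of
      \<open>weight_count_below\<close>, whose condition becomes \<open>2 + i < d\<close>.\<close>
    obtain u where u: "u \<in> V" "hamming_weight u = 2"
      using coset_weight_attained[OF C(1) \<open>is_coset C V\<close>] \<open>coset_weight V = 2\<close> by metis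
    show ?thesis
      using weight_count_below[OF C(1) \<open>is_coset C V\<close> u(1), of i] u(2) C(2) \<open>i < d - 2\<close> by simp
  qed
  have D_low: "D i = 0" if "i < d - 2" for i
    using low[OF assms(3,4) that] low[OF assms(5,6) that] by (simp add: D_def)
  define E where "E j = D (d - 2 + j)" for j
  have "(\<Sum>j\<le>m. E j * int ((m - j) choose t)) = 0" if "t < m" for t
  proof -
    have t: "t \<le> k" using that by (simp add: m_def)
    have "(\<Sum>j\<le>m. E j * int ((m - j) choose t)) = (\<Sum>i\<in>{d - 2..n}. D i * int ((n - i) choose t))"
      unfolding E_def n
      by (rule sum.reindex_bij_witness[of _ "\<lambda>i. i - (d - 2)" "\<lambda>j. d - 2 + j"]) auto
    \<comment> \<open>The weights below \<open>d - 2\<close> add nothing, so this is the difference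
      of two complete moments, which agree.\<close>
    also have "\<dots> = (\<Sum>i\<le>n. D i * int ((n - i) choose t))"
      by (rule sum.mono_neutral_left) (auto simp: D_low)
    also have "\<dots> = int (\<Sum>i\<le>n. weight_count i Va * ((n - i) choose t)) -
        int (\<Sum>i\<le>n. weight_count i Vb * ((n - i) choose t))"
      by (simp add: D_def left_diff_distrib sum_subtractf)
    also have "\<dots> = 0"
      using coset_binomial_moment[OF assms(1) assms(3) t]
        coset_binomial_moment[OF assms(1) assms(5) t] by simp
    finally show ?thesis .
  qed
  then have E: "E j = (-1) ^ j * int (m choose j) * E 0" if "j \<le> m" for j
    using vanishing_binomial_moments[of m E j] that by simp
  \<comment> \<open>Counted from \<open>d - 2\<close>, the reflection of \<open>w\<close> to
    \<open>n + d - 2 - w\<close> takes \<open>j\<close> to \<open>m - j\<close>.\<close>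
  define j where "j = w - (d - 2)"
  have j: "j \<le> m" "w = d - 2 + j" "n + d - 2 - w = d - 2 + (m - j)"
    using w n assms(2) by (auto simp: j_def)
  \<comment> \<open>A parity count: the factor \<open>(-1) ^ (n + d)\<close> turns the sign
    \<open>(-1) ^ j\<close> into \<open>(-1) ^ (m - j)\<close>.\<close>
  have "n + d + j = (m - j) + 2 * (d + j - 1)" using n assms(2) j(1) by linarith
  then have "(-1::int) ^ (n + d + j) = (-1) ^ (m - j)"
    by (simp only: power_add power_mult) simp
  then have "(-1::int) ^ (n + d) * (-1) ^ j = (-1) ^ (m - j)"
    by (simp only: power_add)
  \<comment> \<open>Both sides are the same multiple of \<open>E 0\<close>, the difference at weight
    \<open>d - 2\<close>, whatever its value.\<close>
  then have "(-1) ^ (n + d) * E j = E (m - j)"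
    using E[OF j(1)] E[of "m - j"] binomial_symmetric[OF j(1)]
    by (simp add: mult.assoc[symmetric])
  then have "(-1) ^ (n + d) * D w = D (n + d - 2 - w)"
    by (simp only: E_def j(3) j(2)[symmetric])
  then show "(- 1) ^ (n + d) * int (weight_count w Va) - int (weight_count (n + d - 2 - w) Va) =
    (- 1) ^ (n + d) * int (weight_count w Vb) - int (weight_count (n + d - 2 - w) Vb)"
    by (simp add: D_def algebra_simps)
qed

end
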